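(* Let $\alpha\in[0,1]$ and let $\mathcal G$ be a non-abelian group of order $n=pq$, where $p<q$ are primes. Then the $A_\alpha$-spectrum of the power graph $\mathcal P(\mathcal G)$ consists of the eigenvalue $\alpha p-1$ with multiplicity $q(p-2)$, the eigenvalue $\alpha q-1$ with multiplicity $q-2$, and the $q+2$ eigenvalues of the $(q+2)\times(q+2)$ matrix $$M=\begin{pmatrix}\alpha(pq-1) & (1-\alpha)(p-1) & \cdots & (1-\alpha)(p-1) & (1-\alpha)(q-1)\\ 1-\alpha & \alpha+p-2 & \cdots & 0 & 0\\ \vdots & \vdots & \ddots & \vdots & \vdots\\ 1-\alpha & 0 & \cdots & \alpha+p-2 & 0\\ 1-\alpha & 0 & \cdots & 0 & \alpha+q-2\end{pmatrix},$$ in which the entry $(1-\alpha)(p-1)$ appears $q$ times in the first row, the diagonal entry $\alpha+p-2$ appears $q$ times, and all entries not shown are $0$.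
   Context: For a simple graph $G$ with adjacency matrix $A(G)$ and diagonal degree matrix $D(G)$, and $\alpha\in[0,1]$, $A_\alpha(G)=\alpha D(G)+(1-\alpha)A(G)$; its $A_\alpha$-spectrum is the multiset of its eigenvalues. The power graph $\mathcal P(\mathcal G)$ of a finite group $\mathcal G$ has vertex set $\mathcal G$, two distinct elements $x,y$ being adjacent iff one is a positive power of the other. *)

theory Defs
  imports
    "HOL-Algebra.Coset"
    "HOL-Computational_Algebra.Primes"
    "HOL-Computational_Algebra.Polynomial"
    "Graph_Theory.Pair_Digraph"
    "Jordan_Normal_Form.Char_Poly"
begin

text \<open>A simple graph is represented as a symmetric loop-free pair digraph
  (\<^const>\<open>pair_graph\<close>): an undirected edge \<open>{x, y}\<close> is the pair of arcs
  \<open>(x, y)\<close>, \<open>(y, x)\<close>, so the degree of a vertex is its out-degree.\<close>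

definition power_graph :: "('a, 'b) monoid_scheme \<Rightarrow> 'a pair_pre_digraph" where
  "power_graph G =
     \<lparr> pverts = carrier G,
       parcs = {(x, y). x \<in> carrier G \<and> y \<in> carrier G \<and> x \<noteq> y \<and>
         ((\<exists>k::nat. k > 0 \<and> y = x [^]\<^bsub>G\<^esub> k) \<or> (\<exists>k::nat. k > 0 \<and> x = y [^]\<^bsub>G\<^esub> k))} \<rparr>"

lemma pair_graph_power_graph:
  assumes "finite (carrier G)"
  shows "pair_graph (power_graph G)"
proof -
  have "parcs (power_graph G) \<subseteq> carrier G \<times> carrier G"
    by (auto simp: power_graph_def)
  then have "finite (parcs (power_graph G))"
    using assms by (meson finite_SigmaI finite_subset)
  moreover have "symmetric (with_proj (power_graph G))"
    by (auto simp: symmetric_def sym_def power_graph_def)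
  ultimately show ?thesis
    using assms by unfold_locales (auto simp: power_graph_def)
qed

text \<open>The matrices of a graph are taken with respect to an enumeration \<open>vs\<close> of its vertices.\<close>

definition adjacency_mat :: "'a pair_pre_digraph \<Rightarrow> 'a list \<Rightarrow> real mat" where
  "adjacency_mat H vs =
     mat (length vs) (length vs) (\<lambda>(i, j). if (vs ! i, vs ! j) \<in> parcs H then 1 else 0)"

definition degree_mat :: "'a pair_pre_digraph \<Rightarrow> 'a list \<Rightarrow> real mat" where
  "degree_mat H vs =
     mat (length vs) (length vs)
       (\<lambda>(i, j). if i = j then real (out_degree (with_proj H) (vs ! i)) else 0)"

definition A_alpha :: "real \<Rightarrow> 'a pair_pre_digraph \<Rightarrow> 'a list \<Rightarrow> real mat" where
  "A_alpha \<alpha> H vs = \<alpha> \<cdot>\<^sub>m degree_mat H vs + (1 - \<alpha>) \<cdot>\<^sub>m adjacency_mat H vs"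

text \<open>Eigenvalues are counted with algebraic multiplicity. They are taken over the complex numbers,
  so that a real \<open>n \<times> n\<close> matrix always has exactly \<open>n\<close> of them.\<close>

definition mat_spectrum :: "real mat \<Rightarrow> complex multiset" where
  "mat_spectrum A = proots (char_poly (map_mat complex_of_real A))"

definition quotient_mat :: "real \<Rightarrow> nat \<Rightarrow> nat \<Rightarrow> real mat" where
  "quotient_mat \<alpha> p q = mat (q + 2) (q + 2) (\<lambda>(i, j).
     if i = 0 then
       (if j = 0 then \<alpha> * (real p * real q - 1)
        else if j \<le> q then (1 - \<alpha>) * (real p - 1)
        else (1 - \<alpha>) * (real q - 1))
     else if j = 0 then 1 - \<alpha>
     else if i = j then (if i \<le> q then \<alpha> + real p - 2 else \<alpha> + real q - 2)
     else 0)"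

end

theory Submission
  imports
    Defs
    "HOL-Algebra.Sylow"
    "HOL-Algebra.Multiplicative_Group"
begin

text \<open>Since \<open>G\<close> is not cyclic, every non-identity element has order \<open>p\<close> or \<open>q\<close>; there is only one subgroup
  of order \<open>q\<close>, because two of them would give \<open>q\<^sup>2 > pq\<close> products, and counting leaves exactly \<open>q\<close>
  subgroups of order \<open>p\<close>. Hence the power graph consists of \<open>q\<close> copies of \<open>K\<^sub>p\<close> and one \<open>K\<^sub>q\<close> glued
  at the identity. With respect to the partition into the identity and the punctured subgroups,
  \<open>A\<^sub>\<alpha> = L + U V\<close>, where \<open>U\<close> is the incidence matrix of vertices and classes, \<open>L\<close> is diagonal and
  constant on classes, and the columns of \<open>V\<close> depend only on the class. As \<open>L U = U L'\<close> for the diagonal matrix \<open>L'\<close>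
  of class values, a block similarity gives
  \<open>\<chi>(L + U V) \<chi>(L') = \<chi>(L) \<chi>(L' + V U)\<close>, and \<open>L' + V U\<close> is the quotient matrix.\<close>

section \<open>Characteristic polynomials and equitable partitions\<close>

lemma char_poly_four_block_upper_right_zero:
  fixes A :: "'a :: idom mat"
  assumes A: "A \<in> carrier_mat n n" and C: "C \<in> carrier_mat m n" and D: "D \<in> carrier_mat m m"
  shows "char_poly (four_block_mat A (0\<^sub>m n m) C D) = char_poly A * char_poly D"
proof -
  have "char_poly_matrix (four_block_mat A (0\<^sub>m n m) C D) =
      four_block_mat (char_poly_matrix A) (0\<^sub>m n m) (map_mat (\<lambda>a. [:-a:]) C) (char_poly_matrix D)"
    using A C D by (intro eq_matI) (auto simp: char_poly_matrix_def)
  moreover have "det (four_block_mat (char_poly_matrix A) (0\<^sub>m n m) (map_mat (\<lambda>a. [:-a:]) C) (char_poly_matrix D))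
      = det (char_poly_matrix A) * det (char_poly_matrix D)"
    using A C D by (intro det_four_block_mat_upper_right_zero[of _ n _ m]) auto
  ultimately show ?thesis
    by (simp add: char_poly_def)
qed

text \<open>The block lower triangular matrices with diagonal blocks \<open>L + U * V\<close>,
  \<open>L'\<close> and \<open>L\<close>, \<open>L' + V * U\<close> are conjugate under the
  unipotent block matrix with upper right corner \<open>U\<close>. For \<open>L = 0\<close> and
  \<open>L' = 0\<close> this is the classical relation between the characteristic polynomials of
  \<open>U * V\<close> and \<open>V * U\<close>.\<close>

lemma char_poly_add_intertwined:
  fixes L :: "'a :: idom mat"
  assumes L: "L \<in> carrier_mat n n" and L': "L' \<in> carrier_mat m m"
    and U: "U \<in> carrier_mat n m" and V: "V \<in> carrier_mat m n"
    and comm: "L * U = U * L'"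
  shows "char_poly (L + U * V) * char_poly L' = char_poly L * char_poly (L' + V * U)"
proof -
  define T where "T = four_block_mat (1\<^sub>m n) U (0\<^sub>m m n) (1\<^sub>m m)"
  define T' where "T' = four_block_mat (1\<^sub>m n) (- U) (0\<^sub>m m n) (1\<^sub>m m)"
  define X where "X = four_block_mat L (0\<^sub>m n m) V (L' + V * U)"
  define Y where "Y = four_block_mat (L + U * V) (0\<^sub>m n m) V L'"
  note carr = L L' U V
  have dims: "T \<in> carrier_mat (n + m) (n + m)" "T' \<in> carrier_mat (n + m) (n + m)"
      "X \<in> carrier_mat (n + m) (n + m)" "Y \<in> carrier_mat (n + m) (n + m)"
    using carr by (auto simp: T_def T'_def X_def Y_def)
  have one: "four_block_mat (1\<^sub>m n) (0\<^sub>m n m) (0\<^sub>m m n) (1\<^sub>m m) = (1\<^sub>m (n + m) :: 'a mat)"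
    by (intro eq_matI) auto
  have neg0: "- (0\<^sub>m m m :: 'a mat) = 0\<^sub>m m m"
    by (intro eq_matI) auto
  have TT': "T * T' = 1\<^sub>m (n + m)"
    unfolding T_def T'_def one[symmetric] using carr
    by (subst mult_four_block_mat[of _ n n _ m _ m _ _ n _ m]) 
       (auto simp: neg0 uminus_l_inv_mat intro!: arg_cong2[of _ _ _ _ "\<lambda>x y. four_block_mat x y _ _"])
  have T'T: "T' * T = 1\<^sub>m (n + m)"
    unfolding T_def T'_def one[symmetric] using carr
    by (subst mult_four_block_mat[of _ n n _ m _ m _ _ n _ m]) 
       (auto simp: neg0 comm_add_mat[of U n m] uminus_l_inv_mat intro!: arg_cong2[of _ _ _ _ "\<lambda>x y. four_block_mat x y _ _"])
  \<comment> \<open>The intertwining hypothesis enters only here: it makes the upper right blocks of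
    \<open>Y * T\<close> and \<open>T * X\<close> agree.\<close>
  have UL: "U * (L' + V * U) = L * U + U * V * U"
    using carr by (simp add: comm mult_add_distrib_mat[of _ n m _ m] assoc_mult_mat[of _ n m _ n _ m])
  have YT: "Y * T = four_block_mat (L + U * V) (U * (L' + V * U)) V (L' + V * U)"
    unfolding T_def Y_def UL using carr
    by (subst mult_four_block_mat[of _ n n _ m _ m _ _ n _ m]) 
       (auto simp: add_mult_distrib_mat[of _ n n _ _ m] comm_add_mat[of _ m m])
  have TX: "T * X = four_block_mat (L + U * V) (U * (L' + V * U)) V (L' + V * U)"
    unfolding T_def X_def using carr
    by (subst mult_four_block_mat[of _ n n _ m _ m _ _ n _ m]) auto
  have "Y = Y * (T * T')"
    using dims by (simp add: TT')
  also have "\<dots> = Y * T * T'"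
    using dims by (simp add: assoc_mult_mat[of _ "n+m" "n+m" _ "n+m" _ "n+m"])
  also have "Y * T = T * X"
    by (simp add: YT TX)
  finally have "similar_mat Y X"
    using dims TT' T'T by (intro similar_matI[of _ _ T T' "n + m"]) auto
  then have "char_poly Y = char_poly X"
    by (rule char_poly_similar)
  then show ?thesis
    using carr unfolding X_def Y_def by (simp add: char_poly_four_block_upper_right_zero[of _ n _ m])
qed

lemma char_poly_diagonal:
  "char_poly (mat n n (\<lambda>(i, j). if i = j then d i else 0)) = (\<Prod>i<n. [:- d i, 1:])"
proof -
  have "char_poly (mat n n (\<lambda>(i, j). if i = j then d i else 0)) =
      (\<Prod>a\<leftarrow>diag_mat (mat n n (\<lambda>(i, j). if i = j then d i else 0)). [:- a, 1:])"
    by (rule char_poly_upper_triangular[of _ n]) auto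
  also have "diag_mat (mat n n (\<lambda>(i, j). if i = j then d i else 0)) = map d [0..<n]"
    by (auto simp: diag_mat_def)
  finally show ?thesis
    by (simp add: prod.list_conv_set_nth atLeast0LessThan)
qed

text \<open>Here \<open>c\<close> sends an index to its class. Up to a diagonal term that is
  constant on classes, the entries of \<open>A\<close> depend only on the classes, so that part
  factors through the incidence matrix; multiplying in the other order sums \<open>b\<close> over a
  class and produces the class sizes in \<open>M\<close>. The product form avoids dividing
  polynomials.\<close>

lemma char_poly_equitable:
  fixes d :: "nat \<Rightarrow> 'a :: idom" and b :: "nat \<Rightarrow> nat \<Rightarrow> 'a" and c :: "nat \<Rightarrow> nat"
  assumes c: "\<And>i. i < n \<Longrightarrow> c i < m"
    and A: "A = mat n n (\<lambda>(i, j). (if i = j then d (c i) else 0) + b (c i) (c j))"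
    and M: "M = mat m m (\<lambda>(i, j). (if i = j then d i else 0) + b i j * of_nat (card {v. v < n \<and> c v = j}))"
  shows "char_poly A * (\<Prod>i<m. [:- d i, 1:]) = (\<Prod>i<n. [:- d (c i), 1:]) * char_poly M"
proof -
  define L where "L = mat n n (\<lambda>(i, j). if i = j then d (c i) else 0)"
  define L' where "L' = mat m m (\<lambda>(i, j). if i = j then d i else 0)"
  define U where "U = mat n m (\<lambda>(i, j). if c i = j then 1 else 0 :: 'a)"
  define V where "V = mat m n (\<lambda>(i, j). b i (c j))"
  note defs = L_def L'_def U_def V_def
  have LU: "L * U = U * L'"
  proof (rule eq_matI)
    fix i j assume "i < dim_row (U * L')" "j < dim_col (U * L')"
    then have ij: "i < n" "j < m" by (auto simp: defs)
    have "(L * U) $$ (i, j) = (\<Sum>k<n. (if i = k then d (c i) else 0) * (if c k = j then 1 else 0))"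
      using ij by (auto simp: defs scalar_prod_def atLeast0LessThan intro!: sum.cong)
    also have "\<dots> = (\<Sum>k<n. if k = i then d (c i) * (if c i = j then 1 else 0) else 0)"
      by (rule sum.cong) auto
    \<comment> \<open>The one surviving term is re-expanded as a sum over classes, which requires
      \<open>c i < m\<close>.\<close>
    also have "\<dots> = (\<Sum>k<m. if k = c i then (if k = j then d j else 0) else 0)"
      using ij c[of i] by simp
    also have "\<dots> = (\<Sum>k<m. (if c i = k then 1 else 0) * (if k = j then d k else 0))"
      by (rule sum.cong) auto
    also have "\<dots> = (U * L') $$ (i, j)"
      using ij by (simp add: defs scalar_prod_def atLeast0LessThan)
    finally show "(L * U) $$ (i, j) = (U * L') $$ (i, j)" .
  qed (auto simp: defs)
  have A': "A = L + U * V"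
  proof (rule eq_matI)
    fix i j assume "i < dim_row (L + U * V)" "j < dim_col (L + U * V)"
    then have ij: "i < n" "j < n" by (auto simp: defs)
    have "(U * V) $$ (i, j) = (\<Sum>k<m. (if c i = k then 1 else 0) * b k (c j))"
      using ij by (simp add: defs scalar_prod_def atLeast0LessThan)
    also have "\<dots> = (\<Sum>k<m. if k = c i then b k (c j) else 0)"
      by (rule sum.cong) auto
    also have "\<dots> = b (c i) (c j)"
      using ij c[of i] by simp
    finally show "A $$ (i, j) = (L + U * V) $$ (i, j)"
      using ij by (simp add: A defs)
  qed (auto simp: A defs)
  have M': "M = L' + V * U"
  proof (rule eq_matI)
    fix i j assume "i < dim_row (L' + V * U)" "j < dim_col (L' + V * U)"
    then have ij: "i < m" "j < m" by (auto simp: defs)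
    have "(V * U) $$ (i, j) = (\<Sum>k<n. b i (c k) * (if c k = j then 1 else 0))"
      using ij by (simp add: defs scalar_prod_def atLeast0LessThan)
    also have "\<dots> = (\<Sum>k<n. if c k = j then b i j else 0)"
      by (rule sum.cong) auto
    also have "\<dots> = (\<Sum>k\<in>{v. v < n \<and> c v = j}. b i j)"
      by (intro sum.mono_neutral_cong_right) auto
    also have "\<dots> = b i j * of_nat (card {v. v < n \<and> c v = j})"
      by (simp add: mult.commute)
    finally show "M $$ (i, j) = (L' + V * U) $$ (i, j)"
      using ij by (simp add: M defs)
  qed (auto simp: M defs)
  have "char_poly (L + U * V) * char_poly L' = char_poly L * char_poly (L' + V * U)"
    by (rule char_poly_add_intertwined[OF _ _ _ _ LU]) (auto simp: defs)
  then show ?thesis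
    by (simp only: A'[symmetric] M'[symmetric]) (simp add: L_def L'_def char_poly_diagonal)
qed
text \<open>Comparing roots in the product identity, class \<open>j\<close> contributes
  \<open>k j\<close> copies of \<open>d j\<close> on one side and a single copy on the other.
  Surjectivity of \<open>c\<close> makes every class nonempty, so this single copy cancels.\<close>

lemma proots_char_poly_equitable:
  fixes d :: "nat \<Rightarrow> 'a :: idom" and b :: "nat \<Rightarrow> nat \<Rightarrow> 'a" and c :: "nat \<Rightarrow> nat" and n :: nat
  defines "k \<equiv> \<lambda>j. card {v. v < n \<and> c v = j}"
  assumes c: "c ` {..<n} = {..<m}"
    and A: "A = mat n n (\<lambda>(i, j). (if i = j then d (c i) else 0) + b (c i) (c j))"
    and M: "M = mat m m (\<lambda>(i, j). (if i = j then d i else 0) + b i j * of_nat (k j))"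
  shows "proots (char_poly A) = (\<Sum>j<m. replicate_mset (k j - 1) (d j)) + proots (char_poly M)"
proof -
  have k: "k j > 0" if "j < m" for j
  proof -
    have "j \<in> c ` {..<n}"
      using that by (simp add: c)
    then have "{v. v < n \<and> c v = j} \<noteq> {}"
      by blast
    then show ?thesis
      by (simp add: k_def card_gt_0_iff)
  qed
  have nz: "char_poly A \<noteq> 0" "char_poly M \<noteq> 0"
    using degree_monic_char_poly[of A n] degree_monic_char_poly[of M m] by (auto simp: A M)
  have "char_poly A * (\<Prod>i<m. [:- d i, 1:]) = (\<Prod>i<n. [:- d (c i), 1:]) * char_poly M"
    using c A M unfolding k_def by (intro char_poly_equitable) auto
  from arg_cong[OF this, of proots]
  have "proots (char_poly A) + (\<Sum>j<m. {#d j#}) = (\<Sum>i<n. {#d (c i)#}) + proots (char_poly M)"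
    using nz by (simp add: proots_mult proots_prod)
  also have "(\<Sum>i<n. {#d (c i)#}) = (\<Sum>j<m. \<Sum>i | i \<in> {..<n} \<and> c i = j. {#d (c i)#})"
    using c by (intro sum.group[symmetric]) auto
  also have "\<dots> = (\<Sum>j<m. replicate_mset (k j) (d j))"
  proof (rule sum.cong[OF refl])
    fix j
    have "(\<Sum>i | i \<in> {..<n} \<and> c i = j. {#d (c i)#}) = (\<Sum>i | i < n \<and> c i = j. {#d j#})"
      by (rule sum.cong) auto
    then show "(\<Sum>i | i \<in> {..<n} \<and> c i = j. {#d (c i)#}) = replicate_mset (k j) (d j)"
      by (intro multiset_eqI) (simp add: k_def count_sum)
  qed
  \<comment> \<open>Splitting off one copy is sound for truncated subtraction because
    \<open>k j > 0\<close>.\<close>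
  also have "\<dots> = (\<Sum>j<m. replicate_mset (k j - 1) (d j) + {#d j#})"
  proof (rule sum.cong[OF refl])
    fix j assume "j \<in> {..<m}"
    then show "replicate_mset (k j) (d j) = replicate_mset (k j - 1) (d j) + {#d j#}"
      using k[of j] by (cases "k j") auto
  qed
  finally have "proots (char_poly A) + (\<Sum>j<m. {#d j#}) =
      ((\<Sum>j<m. replicate_mset (k j - 1) (d j)) + proots (char_poly M)) + (\<Sum>j<m. {#d j#})"
    by (simp only: sum.distrib add_ac)
  then show ?thesis
    by (rule add_right_imp_eq)
qed

section \<open>The power graph of a group of order \<open>pq\<close>\<close>

context group begin

text \<open>The order of \<open>y\<close> divides the prime \<open>ord x\<close> and is not 1, so
  the two cyclic subgroups have the same finite size and one contains the other.\<close>

lemma generate_eq_of_mem_prime_ord: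
  assumes fin: "finite (carrier G)" and x: "x \<in> carrier G" and "prime (ord x)"
    and y: "y \<in> generate G {x}" "y \<noteq> \<one>"
  shows "generate G {y} = generate G {x}"
proof (rule card_subset_eq)
  have yc: "y \<in> carrier G"
    using y x generate_incl[of "{x}"] by auto
  show "finite (generate G {x})"
    using fin generate_incl[of "{x}"] x by (auto intro: finite_subset)
  show sub: "generate G {y} \<subseteq> generate G {x}"
    using generate_subgroup_incl[of "{y}" "generate G {x}"] generate_is_subgroup[of "{x}"] x y by auto
  obtain k :: nat where k: "y = x [^] k"
    using y generate_pow_on_finite_carrier[OF fin x] by auto
  have "y [^] ord x = \<one>"
    using x by (metis k mult.commute nat_pow_one nat_pow_pow pow_ord_eq_1)
  then have "ord y dvd ord x"
    using pow_eq_id[OF yc] by simp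
  moreover have "ord y \<noteq> 1"
    using ord_eq_1[OF yc] y by simp
  ultimately have "ord y = ord x"
    using \<open>prime (ord x)\<close> by (auto simp: prime_nat_iff)
  then show "card (generate G {y}) = card (generate G {x})"
    using generate_pow_card x yc by simp
qed

lemma generate_eq_iff_mem_prime_ord:
  assumes "finite (carrier G)" "x \<in> carrier G" "prime (ord x)" "y \<in> carrier G" "y \<noteq> \<one>"
  shows "generate G {y} = generate G {x} \<longleftrightarrow> y \<in> generate G {x}"
  using assms generate_eq_of_mem_prime_ord generate.incl[of y "{y}" G] by blast

text \<open>In a finite group the identity is the positive power \<open>z [^] ord z\<close> of every
  \<open>z\<close>, hence adjacent to all other vertices.\<close>

lemma power_graph_arc_one_iff:
  assumes fin: "finite (carrier G)"
    and x: "x \<in> carrier G" and y: "y \<in> carrier G" and "x = \<one> \<or> y = \<one>"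
  shows "(x, y) \<in> parcs (power_graph G) \<longleftrightarrow> x \<noteq> y"
proof -
  have "\<exists>k>0. \<one> = z [^] (k::nat)" if "z \<in> carrier G" for z
    using pow_ord_eq_1[OF that] ord_ge_1[OF fin that] by (intro exI[of _ "ord z"]) auto
  then show ?thesis
    using assms by (auto simp: power_graph_def)
qed

text \<open>Among elements of prime order, being a power of one another is symmetric: each of the
  two directions means generating the same subgroup. Punctured subgroups of prime order are
  therefore cliques without arcs between them.\<close>

lemma power_graph_arc_prime_ord_iff:
  assumes fin: "finite (carrier G)"
    and x: "x \<in> carrier G" "prime (ord x)" and y: "y \<in> carrier G" "prime (ord y)"
  shows "(x, y) \<in> parcs (power_graph G) \<longleftrightarrow> x \<noteq> y \<and> generate G {x} = generate G {y}"
proof -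
  have ne: "x \<noteq> \<one>" "y \<noteq> \<one>"
    using x y by auto
  \<comment> \<open>Exponent 0 would yield the identity, so \<open>v \<noteq> \<one>\<close> turns
    membership in the cyclic subgroup into a positive power.\<close>
  have pow: "(\<exists>k::nat. k > 0 \<and> v = u [^] k) \<longleftrightarrow> generate G {v} = generate G {u}"
    if "u \<in> carrier G" "prime (ord u)" "v \<in> carrier G" "v \<noteq> \<one>" for u v
    unfolding generate_eq_iff_mem_prime_ord[OF fin that]
    unfolding generate_pow_on_finite_carrier[OF fin that(1)]
    using that by (auto intro: gr0I) (metis gr0I nat_pow_0)
  show ?thesis
    unfolding power_graph_def
    using pow[OF x y(1) ne(2)] pow[OF y x(1) ne(1)] x y by auto
qed

text \<open>Such an element generates the whole group, which is then cyclic. This rules out elements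
  of order \<open>p * q\<close> in the non-abelian case.\<close>

lemma comm_group_of_ord_eq_order:
  assumes fin: "finite (carrier G)" and x: "x \<in> carrier G" and "ord x = Coset.order G"
  shows "comm_group G"
proof (rule group_comm_groupI)
  have "generate G {x} = carrier G"
    using assms generate_incl[of "{x}"] generate_pow_card[OF x]
    by (intro card_subset_eq) (auto simp: Coset.order_def)
  then have pow: "\<exists>k::nat. y = x [^] k" if "y \<in> carrier G" for y
    using that generate_pow_on_finite_carrier[OF fin x] by auto
  fix y z assume "y \<in> carrier G" "z \<in> carrier G"
  then obtain k l :: nat where "y = x [^] k" "z = x [^] l"
    using pow by blast
  then show "y \<otimes> z = z \<otimes> y"
    using x by (simp add: nat_pow_mult add.commute)
qed

lemma card_subgroup_dvd:
  assumes "subgroup H G" "subgroup K G" "H \<subseteq> K"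
  shows "card H dvd card K"
proof -
  interpret K: group "G\<lparr>carrier := K\<rparr>"
    using assms subgroup_imp_group by blast
  have "subgroup H (G\<lparr>carrier := K\<rparr>)"
    using assms by (rule subgroup_incl)
  then have "card (rcosets\<^bsub>G\<lparr>carrier := K\<rparr>\<^esub> H) * card H = card K"
    using K.lagrange by (simp add: Coset.order_def)
  then show ?thesis
    by (metis dvd_triv_right)
qed

text \<open>Distinct subgroups of prime order \<open>q\<close> meet trivially, so products
  \<open>h \<otimes> k\<close> are pairwise distinct and there would be \<open>q * q\<close> of
  them.\<close>

lemma unique_subgroup_of_large_prime_order:
  assumes fin: "finite (carrier G)" and q: "prime q" and large: "Coset.order G < q * q"
    and H: "subgroup H G" "card H = q" and K: "subgroup K G" "card K = q"
  shows "H = K"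
proof (rule ccontr)
  assume "H \<noteq> K"
  have Hc: "H \<subseteq> carrier G" and Kc: "K \<subseteq> carrier G"
    using H K by (auto dest: subgroup.subset)
  have fHK: "finite H" "finite K"
    using Hc Kc fin finite_subset by auto
  have "subgroup (H \<inter> K) G"
    using H K by (simp add: subgroups_Inter_pair)
  then have "card (H \<inter> K) dvd q"
    using card_subgroup_dvd[of "H \<inter> K" H] H by simp
  moreover have "card (H \<inter> K) \<noteq> q"
    using \<open>H \<noteq> K\<close> H K fHK by (metis Int_lower1 Int_lower2 card_subset_eq)
  ultimately have "card (H \<inter> K) = 1"
    using q by (auto simp: prime_nat_iff)
  moreover have "\<one> \<in> H \<inter> K"
    using H K by (simp add: subgroup.one_closed)
  ultimately have triv: "H \<inter> K = {\<one>}"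
    by (metis card_1_singletonE singletonD)
  have "inj_on (\<lambda>(h, k). h \<otimes> k) (H \<times> K)"
  proof (rule inj_onI, clarify)
    fix h k h' k' assume *: "h \<in> H" "k \<in> K" "h' \<in> H" "k' \<in> K" "h \<otimes> k = h' \<otimes> k'"
    then have c: "h \<in> carrier G" "k \<in> carrier G" "h' \<in> carrier G" "k' \<in> carrier G"
      using Hc Kc by auto
    \<comment> \<open>The left side lies in \<open>H\<close> and the right side in \<open>K\<close>,
      so both lie in the trivial intersection.\<close>
    have "inv h' \<otimes> h = k' \<otimes> inv k"
      using *(5) c by (metis inv_closed inv_solve_left inv_solve_right m_assoc m_closed)
    moreover have "inv h' \<otimes> h \<in> H" "k' \<otimes> inv k \<in> K"
      using * H K by (auto simp: subgroup.m_closed subgroup.m_inv_closed)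
    ultimately have "inv h' \<otimes> h = \<one>" "k' \<otimes> inv k = \<one>"
      using triv by auto
    then show "h = h' \<and> k = k'"
      using c by (metis inv_closed inv_equality inv_inv)
  qed
  moreover have "(\<lambda>(h, k). h \<otimes> k) ` (H \<times> K) \<subseteq> carrier G"
    using Hc Kc by auto
  ultimately have "card (H \<times> K) \<le> Coset.order G"
    unfolding Coset.order_def using fin by (metis card_inj_on_le)
  then show False
    using large H K by (simp add: card_cartesian_product)
qed

end

lemma dvd_prime_prod_cases:
  fixes p q d :: nat
  assumes "prime p" "prime q" "d dvd p * q"
  shows "d \<in> {1, p, q, p * q}"
proof -
  obtain a b where "d = a * b" "a dvd p" "b dvd q"
    using division_decomp[OF assms(3)] by blast
  moreover from this have "a = 1 \<or> a = p" "b = 1 \<or> b = q"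
    using assms by (auto simp: prime_nat_iff)
  ultimately show ?thesis
    by auto
qed

text \<open>The labels follow the rows of \<open>quotient_mat\<close>: 0 for the identity, 1 to
  \<open>q\<close> for the punctured subgroups of order \<open>p\<close>, and \<open>q + 1\<close>
  for the punctured subgroup of order \<open>q\<close>.\<close>

lemma (in group) power_graph_classes:
  assumes nonab: "\<not> comm_group G"
    and p: "prime p" and q: "prime q" and pq: "p < q" and ord: "Coset.order G = p * q"
  obtains c :: "'a \<Rightarrow> nat" where
    "\<And>x. x \<in> carrier G \<Longrightarrow> c x < q + 2"
    "\<And>x y. x \<in> carrier G \<Longrightarrow> y \<in> carrier G \<Longrightarrow>
       (x, y) \<in> parcs (power_graph G) \<longleftrightarrow> x \<noteq> y \<and> (c x = 0 \<or> c y = 0 \<or> c x = c y)"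
    "\<And>i. i < q + 2 \<Longrightarrow> card {x \<in> carrier G. c x = i} =
       (if i = 0 then 1 else if i \<le> q then p - 1 else q - 1)"
proof -
  have p2: "p \<ge> 2" and q2: "q \<ge> 2"
    using p q by (auto simp: prime_ge_2_nat)
  \<comment> \<open>An infinite group has \<open>order\<close> 0, whereas \<open>p * q\<close> is
    positive.\<close>
  have fin: "finite (carrier G)"
    using ord p2 q2 by (metis mult_eq_0_iff not_numeral_le_zero order_gt_0_iff_finite gr0I)
  have ordx: "ord x = p \<or> ord x = q" if "x \<in> carrier G" "x \<noteq> \<one>" for x
  proof -
    have "ord x \<in> {1, p, q, p * q}"
      using dvd_prime_prod_cases[OF p q] ord_dvd_group_order[OF that(1)] ord by simp
    moreover have "ord x \<noteq> 1"
      using ord_eq_1 that by simp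
    moreover have "ord x \<noteq> p * q"
      using comm_group_of_ord_eq_order[OF fin that(1)] nonab ord by auto
    ultimately show ?thesis by auto
  qed
  have prime_ord: "prime (ord x)" if "x \<in> carrier G" "x \<noteq> \<one>" for x
    using ordx[OF that] p q by auto
  define gen where "gen = (\<lambda>x. generate G {x})"
  have gen_sub: "gen x \<subseteq> carrier G" "subgroup (gen x) G" "\<one> \<in> gen x" "finite (gen x)" "card (gen x) = ord x"
    if "x \<in> carrier G" for x
    using that generate_incl[of "{x}"] generate_is_subgroup[of "{x}"] generate.one[of G "{x}"]
      finite_subset[OF _ fin, of "generate G {x}"] generate_pow_card[of x]
    by (auto simp: gen_def)
  \<comment> \<open>All non-identity elements of a subgroup of prime order generate it.\<close>
  have fiber: "card {y \<in> carrier G. y \<noteq> \<one> \<and> gen y = gen x} = ord x - 1"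
    if x: "x \<in> carrier G" "x \<noteq> \<one>" for x
  proof -
    have "{y \<in> carrier G. y \<noteq> \<one> \<and> gen y = gen x} = gen x - {\<one>}"
      using generate_eq_iff_mem_prime_ord[OF fin x(1) prime_ord[OF x]] gen_sub[OF x(1)]
      by (auto simp: gen_def)
    then show ?thesis
      using gen_sub[OF x(1)] by simp
  qed
  have ord_gen: "ord x = ord y" if "x \<in> carrier G" "y \<in> carrier G" "gen x = gen y" for x y
    using gen_sub(5)[of x] gen_sub(5)[of y] that by simp
  have gen_q: "gen x = gen y" if "x \<in> carrier G" "y \<in> carrier G" "ord x = q" "ord y = q" for x y
    using that gen_sub[of x] gen_sub[of y] ord pq q2
    by (intro unique_subgroup_of_large_prime_order[OF fin q]) auto
  \<comment> \<open>Sylow's theorem for the factorisation \<open>q ^ 1 * p\<close> provides an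
    element of order \<open>q\<close>; without it the class \<open>q + 1\<close> could be
    empty.\<close>
  obtain Q where Q: "subgroup Q G" "card Q = q"
    using sylow_thm[OF q group_axioms, of 1 p] ord fin by (auto simp: mult.commute)
  have "\<not> Q \<subseteq> {\<one>}"
    using Q q2 card_mono[of "{\<one>}" Q] by auto
  then obtain z where z: "z \<in> Q" "z \<noteq> \<one>"
    by blast
  have zc: "z \<in> carrier G"
    by (rule subgroup.mem_carrier[OF Q(1) z(1)])
  have "gen z \<subseteq> Q"
    using generate_subgroup_incl[of "{z}" Q] z Q by (simp add: gen_def)
  then have "ord z dvd q"
    using card_subgroup_dvd[OF gen_sub(2)[OF zc] Q(1)] gen_sub(5)[OF zc] Q by simp
  then have ordz: "ord z = q"
    using ordx[OF zc z(2)] q p2 pq by (auto simp: prime_nat_iff)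
  have Eq: "{x \<in> carrier G. ord x = q} = {y \<in> carrier G. y \<noteq> \<one> \<and> gen y = gen z}"
  proof (intro Collect_cong conj_cong refl)
    fix x assume "x \<in> carrier G"
    then show "ord x = q \<longleftrightarrow> x \<noteq> \<one> \<and> gen x = gen z"
      using gen_q[of x z] ord_gen[of x z] zc ordz q2 by auto
  qed
  have card_Eq: "card {x \<in> carrier G. ord x = q} = q - 1"
    unfolding Eq using fiber[OF zc z(2)] ordz by simp
  define E where "E = {x \<in> carrier G. ord x = p}"
  have finE: "finite E"
    using fin by (simp add: E_def)
  \<comment> \<open>Counting by element order: \<open>p * q = 1 + (q - 1) + card E\<close>.\<close>
  have "carrier G = insert \<one> ({x \<in> carrier G. ord x = q} \<union> E)"
    using ordx by (auto simp: E_def)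
  moreover have "\<one> \<notin> {x \<in> carrier G. ord x = q} \<union> E"
    using p2 q2 by (auto simp: E_def)
  moreover have "{x \<in> carrier G. ord x = q} \<inter> E = {}"
    using pq by (auto simp: E_def)
  ultimately have "card (carrier G) = Suc (q - 1 + card E)"
    using card_Eq fin finE
    by (metis (no_types, lifting) card_Un_disjoint card_insert_disjoint finite_Un finite_insert)
  then have cardE: "card E = q * (p - 1)"
    using ord q2 p2 by (simp add: Coset.order_def algebra_simps)
  have E_ne: "x \<in> carrier G" "x \<noteq> \<one>" "ord x = p" if "x \<in> E" for x
    using that p2 by (auto simp: E_def)
  have fiberE: "{y \<in> E. gen y = gen x} = {y \<in> carrier G. y \<noteq> \<one> \<and> gen y = gen x}" if "x \<in> E" for x
  proof (intro Collect_cong iffI conjI; elim conjE)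
    fix y assume "y \<in> carrier G" "y \<noteq> \<one>" "gen y = gen x"
    then show "y \<in> E"
      using ord_gen[of y x] E_ne[OF that] by (simp add: E_def)
  qed (use E_ne in blast)+
  \<comment> \<open>\<open>E\<close> splits into fibres of \<open>gen\<close>, each of size
    \<open>p - 1\<close>; cancelling this positive factor from \<open>q * (p - 1)\<close> leaves
    exactly \<open>q\<close> subgroups of order \<open>p\<close>.\<close>
  have "card E = (\<Sum>P\<in>gen ` E. card {y \<in> E. gen y = P})"
    using sum.group[OF finE finite_imageI[OF finE] subset_refl, of "\<lambda>_. 1 :: nat" gen] by simp
  also have "\<dots> = (\<Sum>P\<in>gen ` E. p - 1)"
    using fiber E_ne by (intro sum.cong) (auto simp: fiberE)
  finally have "card (gen ` E) = q"
    using cardE p2 by simp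
  then obtain h where h: "bij_betw h (gen ` E) {1..q}"
    using finE by (metis card_atLeastAtMost diff_Suc_1 finite_atLeastAtMost finite_imageI finite_same_card_bij)
  define c where "c = (\<lambda>x. if x = \<one> then 0 else if ord x = q then q + 1 else h (gen x))"
  \<comment> \<open>Numbering the subgroups from 1 to \<open>q\<close> keeps their labels apart from
    the reserved values 0 and \<open>q + 1\<close>.\<close>
  have hE: "h (gen x) \<in> {1..q}" if "x \<in> E" for x
    using bij_betwE[OF h] that by auto
  have inE: "x \<in> E" if "x \<in> carrier G" "x \<noteq> \<one>" "ord x \<noteq> q" for x
    using ordx that by (auto simp: E_def)
  have c0: "c x = 0 \<longleftrightarrow> x = \<one>" if "x \<in> carrier G" for x
    using hE[OF inE, OF that] by (auto simp: c_def)
  have cq: "c x = q + 1 \<longleftrightarrow> ord x = q" if "x \<in> carrier G" for x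
    using hE[OF inE, OF that] q2 by (auto simp: c_def)
  have cgen: "c x = c y \<longleftrightarrow> gen x = gen y"
    if "x \<in> carrier G" "y \<in> carrier G" "x \<noteq> \<one>" "y \<noteq> \<one>" for x y
  proof (cases "ord x = q \<or> ord y = q")
    case True
    then show ?thesis
      using cq[of x] cq[of y] gen_q[of x y] ord_gen[of x y] that by metis
  next
    case False
    then have "x \<in> E" "y \<in> E"
      using inE that by auto
    then have "h (gen x) = h (gen y) \<longleftrightarrow> gen x = gen y"
      using h by (auto simp: bij_betw_def inj_on_def)
    then show ?thesis
      using False that by (simp add: c_def)
  qed
  show thesis
  proof (rule that[of c])
    fix x assume "x \<in> carrier G"
    then show "c x < q + 2"
      using hE[OF inE, of x] by (force simp: c_def)
  next
    fix x y assume xy: "x \<in> carrier G" "y \<in> carrier G"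
    show "(x, y) \<in> parcs (power_graph G) \<longleftrightarrow> x \<noteq> y \<and> (c x = 0 \<or> c y = 0 \<or> c x = c y)"
    proof (cases "x = \<one> \<or> y = \<one>")
      case True
      then show ?thesis
        using power_graph_arc_one_iff[OF fin xy] c0 xy by auto
    next
      case False
      then show ?thesis
        using power_graph_arc_prime_ord_iff[OF fin xy(1) prime_ord xy(2) prime_ord] xy
        by (simp add: c0 cgen) (simp add: gen_def)
    qed
  next
    fix i assume i: "i < q + 2"
    consider "i = 0" | "i \<in> {1..q}" | "i = q + 1"
      using i by fastforce
    then show "card {x \<in> carrier G. c x = i} = (if i = 0 then 1 else if i \<le> q then p - 1 else q - 1)"
    proof cases
      case 1
      then have "{x \<in> carrier G. c x = i} = {\<one>}"
        using c0 by auto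
      then show ?thesis using 1 by simp
    next
      case 2
      then obtain x where x: "x \<in> E" "h (gen x) = i"
        using bij_betw_imp_surj_on[OF h] by (metis imageE)
      then have "c x = i"
        using E_ne[OF x(1)] pq by (auto simp: c_def)
      then have "{y \<in> carrier G. c y = i} = {y \<in> carrier G. y \<noteq> \<one> \<and> gen y = gen x}"
        using cgen[OF _ E_ne(1)[OF x(1)] _ E_ne(2)[OF x(1)]] c0 2 by fastforce
      then show ?thesis
        using fiber[OF E_ne(1,2)[OF x(1)]] E_ne(3)[OF x(1)] 2 by simp
    next
      case 3
      then have "{x \<in> carrier G. c x = i} = {x \<in> carrier G. ord x = q}"
        using cq by auto
      then show ?thesis
        using 3 card_Eq by simp
    qed
  qed
qed

section \<open>The spectrum\<close>

lemma card_index_eq_card_set: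
  assumes "distinct vs"
  shows "card {i. i < length vs \<and> P (vs ! i)} = card {x \<in> set vs. P x}"
proof -
  have "{x \<in> set vs. P x} = (!) vs ` {i. i < length vs \<and> P (vs ! i)}"
    by (auto simp: in_set_conv_nth)
  moreover have "inj_on ((!) vs) {i. i < length vs \<and> P (vs ! i)}"
    using assms by (auto simp: inj_on_def nth_eq_iff_index_eq)
  ultimately show ?thesis
    by (simp add: card_image)
qed

lemma out_degree_with_proj:
  "out_degree (with_proj H) v = card {w. (v, w) \<in> parcs H}"
proof -
  have "out_arcs (with_proj H) v = Pair v ` {w. (v, w) \<in> parcs H}"
    by (auto simp: out_arcs_def)
  then show ?thesis
    by (simp add: out_degree_def card_image inj_on_def)
qed

theorem theorem3p13:
  fixes G :: "('a, 'b) monoid_scheme" and \<alpha> :: real and p q :: nat and vs :: "'a list"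
  assumes "0 \<le> \<alpha>" and "\<alpha> \<le> 1"
    and "group G" and "\<not> comm_group G"
    and "prime p" and "prime q" and "p < q" and "Coset.order G = p * q"
    and "distinct vs" and "set vs = pverts (power_graph G)"
  shows "mat_spectrum (A_alpha \<alpha> (power_graph G) vs) =
           replicate_mset (q * (p - 2)) (complex_of_real (\<alpha> * real p - 1))
         + replicate_mset (q - 2) (complex_of_real (\<alpha> * real q - 1))
         + mat_spectrum (quotient_mat \<alpha> p q)"
proof -
  interpret group G by fact
  have p2: "p \<ge> 2" and q2: "q \<ge> 2"
    using assms by (auto simp: prime_ge_2_nat)
  define k where "k = (\<lambda>i. if i = 0 then 1 else if i \<le> q then p - 1 else q - 1)"
  obtain c where c_less: "\<And>x. x \<in> carrier G \<Longrightarrow> c x < q + 2"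
    and arc: "\<And>x y. x \<in> carrier G \<Longrightarrow> y \<in> carrier G \<Longrightarrow>
       (x, y) \<in> parcs (power_graph G) \<longleftrightarrow> x \<noteq> y \<and> (c x = 0 \<or> c y = 0 \<or> c x = c y)"
    and card_class: "\<And>i. i < q + 2 \<Longrightarrow> card {x \<in> carrier G. c x = i} =
       (if i = 0 then 1 else if i \<le> q then p - 1 else q - 1)"
    by (rule power_graph_classes[OF assms(4-8)]) (erule that)
  have card_c: "card {x \<in> carrier G. c x = i} = k i" if "i < q + 2" for i
    using card_class[OF that] by (simp add: k_def)
  have set_vs: "set vs = carrier G"
    using assms by (simp add: power_graph_def)
  then have fin: "finite (carrier G)"
    by (metis List.finite_set)
  define n where "n = length vs"
  have vs_in: "vs ! i \<in> carrier G" if "i < n" for i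
    using nth_mem[of i vs] that unfolding n_def set_vs by blast
  have card_carrier: "card (carrier G) = p * q"
    using assms by (simp add: Coset.order_def)
  have c_unique: "x = y" if "x \<in> carrier G" "y \<in> carrier G" "c x = 0" "c y = 0" for x y
  proof -
    obtain z where z: "{x \<in> carrier G. c x = 0} = {z}"
      using card_c[of 0] by (auto simp: k_def card_1_singleton_iff)
    have "x \<in> {x \<in> carrier G. c x = 0}" "y \<in> {x \<in> carrier G. c x = 0}"
      using that by simp_all
    then show ?thesis
      unfolding z by simp
  qed
  have nbrs: "{y. (x, y) \<in> parcs (power_graph G)} =
      {y \<in> carrier G. x \<noteq> y \<and> (c x = 0 \<or> c y = 0 \<or> c x = c y)}" if "x \<in> carrier G" for x
  proof (rule Collect_cong)
    fix y
    have "y \<in> carrier G" if "(x, y) \<in> parcs (power_graph G)"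
      using that by (simp add: power_graph_def)
    then show "(x, y) \<in> parcs (power_graph G) \<longleftrightarrow>
        y \<in> carrier G \<and> x \<noteq> y \<and> (c x = 0 \<or> c y = 0 \<or> c x = c y)"
      using arc[OF \<open>x \<in> carrier G\<close>] by blast
  qed
  \<comment> \<open>Outside class 0, a vertex is adjacent to the identity and to the other
    \<open>k (c x) - 1\<close> members of its class, which adds up to
    \<open>k (c x)\<close>.\<close>
  have deg: "out_degree (with_proj (power_graph G)) x = (if c x = 0 then p * q - 1 else k (c x))"
    if x: "x \<in> carrier G" for x
  proof (cases "c x = 0")
    case True
    then have "{y. (x, y) \<in> parcs (power_graph G)} = carrier G - {x}"
      using nbrs[OF x] by auto
    then show ?thesis
      using True x fin card_carrier by (simp add: out_degree_with_proj)
  next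
    case False
    have "{y. (x, y) \<in> parcs (power_graph G)} =
        {y \<in> carrier G. c y = 0} \<union> ({y \<in> carrier G. c y = c x} - {x})"
      unfolding nbrs[OF x] using False by auto
    also have "card \<dots> = card {y \<in> carrier G. c y = 0} + card ({y \<in> carrier G. c y = c x} - {x})"
      using fin False by (intro card_Un_disjoint) auto
    also have "\<dots> = 1 + (k (c x) - 1)"
      using fin x c_less[OF x] by (simp add: card_c card_Diff_singleton) (simp add: k_def)
    finally show ?thesis
      using False p2 q2 by (auto simp: out_degree_with_proj k_def)
  qed
  \<comment> \<open>The value \<open>d i\<close> is the diagonal entry of \<open>A_alpha\<close>
    minus \<open>b i i\<close>. For the classes of size \<open>p - 1\<close> this is
    \<open>\<alpha> * (p - 1) - (1 - \<alpha>) = \<alpha> * p - 1\<close>, and likewise with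
    \<open>q\<close>.\<close>
  define d where "d = (\<lambda>i. if i = 0 then \<alpha> * (real p * real q - 1)
      else if i \<le> q then \<alpha> * real p - 1 else \<alpha> * real q - 1)"
  \<comment> \<open>\<open>b i j\<close> is the entry of \<open>A_alpha\<close> between distinct
    vertices of classes \<open>i\<close> and \<open>j\<close>. Class 0 is a singleton and has no
    such entry with itself; the choice \<open>b 0 0 = 0\<close> makes \<open>d 0\<close> the full
    diagonal entry.\<close>
  define b where "b = (\<lambda>i j :: nat. if i = 0 \<and> j = 0 then 0
      else if i = 0 \<or> j = 0 \<or> i = j then 1 - \<alpha> else 0)"
  define c' where "c' = (\<lambda>i. c (vs ! i))"
  have card_c': "card {v. v < n \<and> c' v = j} = k j" if "j < q + 2" for j
    using card_index_eq_card_set[OF \<open>distinct vs\<close>, of "\<lambda>x. c x = j"] card_c[OF that]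
    by (simp add: n_def c'_def set_vs)
  have k_pos: "k j > 0" for j
    using p2 q2 by (simp add: k_def)
  have img: "c' ` {..<n} = {..<q + 2}"
  proof (intro equalityI subsetI)
    fix j assume "j \<in> {..<q + 2}"
    then have "card {v. v < n \<and> c' v = j} > 0"
      using card_c' k_pos by simp
    then show "j \<in> c' ` {..<n}"
      by (auto simp: card_gt_0_iff)
  qed (use vs_in c_less in \<open>auto simp: c'_def\<close>)
  have A: "map_mat complex_of_real (A_alpha \<alpha> (power_graph G) vs) =
      mat n n (\<lambda>(i, j). (if i = j then complex_of_real (d (c' i)) else 0) +
        complex_of_real (b (c' i) (c' j)))"
    (is "?L = ?R")
  proof (rule eq_matI)
    fix i j assume "i < dim_row ?R" "j < dim_col ?R"
    then have ij: "i < n" "j < n" by auto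
    have "A_alpha \<alpha> (power_graph G) vs $$ (i, j) = (if i = j then d (c' i) else 0) + b (c' i) (c' j)"
    proof (cases "i = j")
      case True
      have "A_alpha \<alpha> (power_graph G) vs $$ (i, j) =
          \<alpha> * real (if c' i = 0 then p * q - 1 else k (c' i))"
        using True ij deg[OF vs_in[OF ij(1)]] arc[OF vs_in[OF ij(1)] vs_in[OF ij(1)]]
        by (simp add: A_alpha_def degree_mat_def adjacency_mat_def c'_def n_def)
      also have "\<dots> = d (c' i) + b (c' i) (c' i)"
        using p2 q2 by (simp add: k_def d_def b_def of_nat_diff algebra_simps)
      finally show ?thesis using True by simp
    next
      case False
      then have ne: "vs ! i \<noteq> vs ! j"
        using ij \<open>distinct vs\<close> by (simp add: n_def nth_eq_iff_index_eq)
      have "\<not> (c' i = 0 \<and> c' j = 0)"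
        using c_unique[OF vs_in[OF ij(1)] vs_in[OF ij(2)]] ne by (auto simp: c'_def)
      then show ?thesis
        using False ij ne arc[OF vs_in[OF ij(1)] vs_in[OF ij(2)]]
        by (auto simp: A_alpha_def degree_mat_def adjacency_mat_def c'_def n_def b_def)
    qed
    moreover have "dim_row (A_alpha \<alpha> (power_graph G) vs) = n" "dim_col (A_alpha \<alpha> (power_graph G) vs) = n"
      by (simp_all add: A_alpha_def degree_mat_def adjacency_mat_def n_def)
    ultimately show "?L $$ (i, j) = ?R $$ (i, j)"
      using ij by simp
  qed (simp_all add: A_alpha_def degree_mat_def adjacency_mat_def n_def)
  have M: "map_mat complex_of_real (quotient_mat \<alpha> p q) =
      mat (q + 2) (q + 2) (\<lambda>(i, j). (if i = j then complex_of_real (d i) else 0) +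
        complex_of_real (b i j) * of_nat (card {v. v < n \<and> c' v = j}))"
    (is "?L = ?R")
  proof (rule eq_matI)
    fix i j assume "i < dim_row ?R" "j < dim_col ?R"
    then have ij: "i < q + 2" "j < q + 2" by auto
    \<comment> \<open>On the diagonal, \<open>\<alpha> * p - 1 + (1 - \<alpha>) * (p - 1) = \<alpha>
      + p - 2\<close>, and likewise with \<open>q\<close>.\<close>
    have "quotient_mat \<alpha> p q $$ (i, j) = (if i = j then d i else 0) + b i j * real (k j)"
      using ij p2 q2 by (auto simp: quotient_mat_def d_def b_def k_def of_nat_diff algebra_simps)
    moreover have "?R $$ (i, j) = complex_of_real ((if i = j then d i else 0) + b i j * real (k j))"
      using ij by (simp add: card_c')
    ultimately show "?L $$ (i, j) = ?R $$ (i, j)"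
      using ij by (simp add: quotient_mat_def)
  qed (simp_all add: quotient_mat_def)
  have "mat_spectrum (A_alpha \<alpha> (power_graph G) vs) =
      (\<Sum>j<q + 2. replicate_mset (card {v. v < n \<and> c' v = j} - 1) (complex_of_real (d j))) +
      mat_spectrum (quotient_mat \<alpha> p q)"
    unfolding mat_spectrum_def by (rule proots_char_poly_equitable[OF img A M])
  also have "(\<Sum>j<q + 2. replicate_mset (card {v. v < n \<and> c' v = j} - 1) (complex_of_real (d j))) =
      (\<Sum>j<q + 2. replicate_mset (k j - 1) (complex_of_real (d j)))"
    by (intro sum.cong) (simp_all add: card_c')
  \<comment> \<open>Class 0 has one element and leaves no extra root; class \<open>q + 1\<close>
    leaves \<open>q - 2\<close> copies, and each of the classes 1 to \<open>q\<close> leaves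
    \<open>p - 2\<close>.\<close>
  also have "{..<q + 2} = insert 0 (insert (q + 1) {1..q})"
    by auto
  also have "(\<Sum>j\<in>\<dots>. replicate_mset (k j - 1) (complex_of_real (d j))) =
      replicate_mset (q - 2) (complex_of_real (\<alpha> * real q - 1)) +
      (\<Sum>j\<in>{1..q}. replicate_mset (k j - 1) (complex_of_real (d j)))"
    by (simp add: k_def d_def numeral_2_eq_2)
  also have "(\<Sum>j\<in>{1..q}. replicate_mset (k j - 1) (complex_of_real (d j))) =
      (\<Sum>j\<in>{1..q}. replicate_mset (p - 2) (complex_of_real (\<alpha> * real p - 1)))"
    by (intro sum.cong) (simp_all add: k_def d_def numeral_2_eq_2)
  also have "\<dots> = replicate_mset (q * (p - 2)) (complex_of_real (\<alpha> * real p - 1))"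
    by (intro multiset_eqI) (simp add: count_sum)
  finally show ?thesis
    by (simp add: add_ac)
qed

end
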